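(* The box dimensions of the full popcorn set $F$ and of the popcorn graph $G_f$ exist and are equal to $4/3$, that is, $\dim_B F = \dim_B G_f = 4/3$.
   Context: The popcorn function $f:[0,1]\to\mathbb{R}$ is defined by $f(x)=1/q$ if $x=p/q$ with $\gcd(p,q)=1$ and $1\le p<q$ integers, and $f(x)=0$ otherwise. The popcorn graph is $G_f=\{(x,f(x)) : x\in[0,1]\}\subset\mathbb{R}^2$. The full popcorn set is $F=\{(p/q,1/q): p,q \text{ positive integers with } p<q\}\cup([0,1]\times\{0\})$. For a non-empty bounded set $X\subset\mathbb{R}^d$ and $\delta>0$, $N_\delta(X)$ denotes the smallest number of closed cubes of side length $\delta$ needed to cover $X$. The upper and lower box dimensions of $X$ are $\overline{\dim}_B X=\limsup_{\delta\to0}\frac{\log N_\delta(X)}{-\log\delta}$ and $\underline{\dim}_B X=\liminf_{\delta\to0}\frac{\log N_\delta(X)}{-\log\delta}$. If they coincide, the common value is the box dimension $\dim_B X$. *)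

theory Defs
  imports "HOL-Analysis.Analysis"
begin

definition cubes :: "real \<Rightarrow> 'a::euclidean_space set set" where
  "cubes \<delta> = {cbox a (a + \<delta> *\<^sub>R One) | a. True}"

text \<open>The covering number and the dimensions are meant for non-empty bounded sets and
  \<open>\<delta> > 0\<close>, where a finite cover exists; elsewhere the values are junk.\<close>

definition covering_number :: "real \<Rightarrow> 'a::euclidean_space set \<Rightarrow> nat" where
  "covering_number \<delta> X =
     (LEAST n. \<exists>\<C>. \<C> \<subseteq> cubes \<delta> \<and> finite \<C> \<and> card \<C> = n \<and> X \<subseteq> \<Union>\<C>)"

definition upper_box_dim :: "'a::euclidean_space set \<Rightarrow> ereal" where
  "upper_box_dim X =
     Limsup (at_right 0) (\<lambda>\<delta>. ereal (ln (real (covering_number \<delta> X)) / (- ln \<delta>)))"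

definition lower_box_dim :: "'a::euclidean_space set \<Rightarrow> ereal" where
  "lower_box_dim X =
     Liminf (at_right 0) (\<lambda>\<delta>. ereal (ln (real (covering_number \<delta> X)) / (- ln \<delta>)))"

definition has_box_dim :: "'a::euclidean_space set \<Rightarrow> real \<Rightarrow> bool" where
  "has_box_dim X s \<longleftrightarrow> lower_box_dim X = ereal s \<and> upper_box_dim X = ereal s"

definition reduced_fraction :: "real \<Rightarrow> nat \<Rightarrow> nat \<Rightarrow> bool" where
  "reduced_fraction x p q \<longleftrightarrow> coprime p q \<and> 1 \<le> p \<and> p < q \<and> x = real p / real q"

text \<open>The popcorn function has domain \<open>[0, 1]\<close>; this total version is only used there.\<close>

definition popcorn :: "real \<Rightarrow> real" where
  "popcorn x =
     (if \<exists>p q. reduced_fraction x p q then 1 / real (THE q. \<exists>p. reduced_fraction x p q) else 0)"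

lemma reduced_fraction_unique:
  assumes "reduced_fraction x p q" "reduced_fraction x p' q'"
  shows "q = q'"
proof -
  have "real p * real q' = real p' * real q"
    using assms by (auto simp: reduced_fraction_def field_simps)
  then have eq: "p * q' = p' * q"
    by (metis of_nat_eq_iff of_nat_mult)
  have "coprime q p" "coprime q' p'"
    using assms by (auto simp: reduced_fraction_def coprime_commute)
  moreover have "q dvd p * q'" "q' dvd p' * q"
    using eq by (metis dvd_triv_right)+
  ultimately show ?thesis
    by (meson coprime_dvd_mult_right_iff dvd_antisym)
qed

lemma popcorn_reduced_fraction:
  assumes "reduced_fraction x p q"
  shows "popcorn x = 1 / real q"
proof -
  have "(THE q. \<exists>p. reduced_fraction x p q) = q"
    using assms reduced_fraction_unique by blast
  then show ?thesis
    using assms by (auto simp: popcorn_def)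
qed

definition popcorn_graph :: "(real \<times> real) set" where
  "popcorn_graph = {(x, popcorn x) | x. x \<in> {0..1}}"

definition full_popcorn_set :: "(real \<times> real) set" where
  "full_popcorn_set =
     {(real p / real q, 1 / real q) | p q :: nat. 0 < p \<and> p < q} \<union> ({0..1} \<times> {0})"

end

theory Submission
  imports Defs "HOL-Number_Theory.Totient" "HOL-Real_Asymp.Real_Asymp"
begin

text \<open>Write \<open>\<delta> = t\<^sup>-\<^sup>3\<close>. Covering the \<open>O(t\<^sup>4)\<close> points with denominator at most \<open>t\<^sup>2\<close> one by one, and the
  remaining strip of height \<open>t\<^sup>-\<^sup>2\<close> by a grid, gives \<open>O(t\<^sup>4)\<close> cubes of side \<open>\<delta>\<close>. For the lower bound let
  \<open>N\<close> be about \<open>t\<^sup>2\<close>. There are at least \<open>N\<^sup>2 / 16\<close> reduced fractions with denominator in \<open>(N/4, N]\<close>,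
  and by Cauchy-Schwarz it is enough that only \<open>O(N\<^sup>2)\<close> pairs of the corresponding points share a
  cube. If \<open>p/q\<close> and \<open>(p + m)/(q + k)\<close> do, then \<open>\<bar>k\<bar> \<le> M\<close> and \<open>\<bar>p k - q m\<bar> \<le> M\<close> with \<open>M \<le> sqrt N\<close>, hence
  \<open>\<bar>m\<bar> \<le> \<bar>k\<bar>\<close>; for fixed \<open>q, k \<noteq> 0, m\<close> there are at most \<open>2M/\<bar>k\<bar> + 1\<close> choices of \<open>p\<close>, so each \<open>(q, k)\<close>
  contributes \<open>O(M)\<close> pairs.\<close>

section \<open>Counting reduced fractions with large denominators\<close>

text \<open>Averages Gauss's identity \<open>n = (\<Sum>d | d dvd n. totient d)\<close> over \<open>n \<le> N\<close>; the divisors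
  \<open>d \<le> N / 4\<close> account for at most half of the total.\<close>

lemma sum_totient_ge:
  "real N ^ 2 / 16 \<le> (\<Sum>q\<in>{q\<in>{1..N}. N < 4 * q}. real (totient q))"
proof -
  have card_mult: "card {n\<in>{1..N}. d dvd n} \<le> N div d" if "d \<in> {1..N}" for d
  proof -
    have "n \<in> (*) d ` {1..N div d}" if "n \<in> {1..N}" "d dvd n" for n
    proof -
      from \<open>d dvd n\<close> obtain e where e: "n = d * e" ..
      then have "e = n div d" "e \<noteq> 0"
        using that \<open>d \<in> {1..N}\<close> by auto
      then show ?thesis
        using that e \<open>d \<in> {1..N}\<close> div_le_mono[of n N d] by (auto intro!: image_eqI[of _ _ e])
    qed
    then have "card {n\<in>{1..N}. d dvd n} \<le> card ((*) d ` {1..N div d})"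
      by (intro card_mono) auto
    also have "\<dots> \<le> N div d"
      using card_image_le[of "{1..N div d}" "(*) d"] by simp
    finally show ?thesis .
  qed
  have "real N ^ 2 / 2 \<le> real (\<Sum>n\<in>{1..N}. n)"
  proof (induction N)
    case (Suc N)
    then show ?case by (simp add: power2_eq_square field_simps)
  qed simp
  \<comment> \<open>Restricting the divisors to the common range \<open>{1..N}\<close> changes
    nothing and lets the two summations be interchanged.\<close>
  also have "(\<Sum>n\<in>{1..N}. n) = (\<Sum>n\<in>{1..N}. \<Sum>d | d \<in> {1..N} \<and> d dvd n. totient d)"
  proof (intro sum.cong refl)
    fix n assume n: "n \<in> {1..N}"
    have "{d. d dvd n} = {d. d \<in> {1..N} \<and> d dvd n}"
    proof (intro Collect_cong iffI conjI)
      fix d assume "d dvd n"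
      then have "d \<le> n" "d \<noteq> 0"
        using n by (auto dest: dvd_imp_le)
      then show "d \<in> {1..N}"
        using n by auto
    qed auto
    then show "n = (\<Sum>d | d \<in> {1..N} \<and> d dvd n. totient d)"
      using totient_divisor_sum[of n] by (simp only:)
  qed
  also have "\<dots> = (\<Sum>d\<in>{1..N}. \<Sum>n | n \<in> {1..N} \<and> d dvd n. totient d)"
    by (rule sum.swap_restrict) auto
  also have "real \<dots> \<le> (\<Sum>d\<in>{1..N}. real (totient d) * (N / d))"
    unfolding of_nat_sum
  proof (rule sum_mono)
    fix d assume d: "d \<in> {1..N}"
    have "real (card {n\<in>{1..N}. d dvd n}) \<le> real N / real d"
      using card_mult[OF d] of_nat_div_le_of_nat[of N d, where ?'a = real] by linarith
    then show "(\<Sum>n | n \<in> {1..N} \<and> d dvd n. real (totient d)) \<le> real (totient d) * (N / d)"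
      by (simp add: mult.commute mult_left_mono del: times_divide_eq_right)
  qed
  \<comment> \<open>For d \<le> N/4 the bound is totient d \<le> d, for larger d it is N/d \<le> 4.
    The at most N/4 small d give at most N^2/4 of the total N^2/2, so four times the wanted sum is
    at least N^2/4: this is the constant 1/16.\<close>
  also have "\<dots> \<le> (\<Sum>d\<in>{1..N}. (if 4 * d \<le> N then real N else 0)
                     + (if N < 4 * d then 4 * real (totient d) else 0))"
  proof (rule sum_mono)
    fix d assume d: "d \<in> {1..N}"
    show "real (totient d) * (N / d) \<le> (if 4 * d \<le> N then real N else 0)
            + (if N < 4 * d then 4 * real (totient d) else 0)"
    proof (cases "4 * d \<le> N")
      case True
      have "real (totient d) * (N / d) \<le> real d * (N / d)"
        using totient_le[of d] by (intro mult_right_mono) auto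
      then show ?thesis using True d by simp
    next
      case False
      have "real N / real d \<le> 4"
        using False d by (simp add: field_simps)
      then have "real (totient d) * (N / d) \<le> real (totient d) * 4"
        by (intro mult_left_mono) auto
      then show ?thesis using False by simp
    qed
  qed
  also have "\<dots> = real N * card {d\<in>{1..N}. 4 * d \<le> N}
      + 4 * (\<Sum>q\<in>{q\<in>{1..N}. N < 4 * q}. real (totient q))"
    by (simp add: sum.distrib sum.inter_filter[symmetric] sum_distrib_left mult.commute)
  also have "real N * card {d\<in>{1..N}. 4 * d \<le> N} \<le> real N * (N / 4)"
  proof -
    have "card {d\<in>{1..N}. 4 * d \<le> N} \<le> card {1..N div 4}"
      by (intro card_mono) auto
    then have "real (card {d\<in>{1..N}. 4 * d \<le> N}) \<le> N / 4"
      using of_nat_div_le_of_nat[of N 4, where ?'a = real] by simp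
    then show ?thesis
      by (intro mult_left_mono) auto
  qed
  finally show ?thesis
    by (simp add: power2_eq_square)
qed

text \<open>The denominator is the first component of a pair.\<close>

definition fraction_pairs :: "nat \<Rightarrow> (nat \<times> nat) set" where
  "fraction_pairs N = (SIGMA q:{q\<in>{1..N}. N < 4 * q}. totatives q)"

lemma finite_fraction_pairs [simp]: "finite (fraction_pairs N)"
  by (auto simp: fraction_pairs_def intro!: finite_SigmaI)

lemma card_fraction_pairs_ge: "real N ^ 2 / 16 \<le> real (card (fraction_pairs N))"
  using sum_totient_ge[of N]
  by (simp add: fraction_pairs_def card_SigmaI totient_def)

section \<open>Counting pairs of close fractions\<close>

lemma card_int_diff_le:
  fixes A :: "int set"
  assumes "finite A" and "\<And>x y. x \<in> A \<Longrightarrow> y \<in> A \<Longrightarrow> x - y \<le> int D"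
  shows "card A \<le> D + 1"
proof (cases "A = {}")
  case False
  have "A \<subseteq> {Min A..Min A + int D}"
  proof
    fix x assume x: "x \<in> A"
    then have "x - Min A \<le> int D"
      using assms(2)[of x "Min A"] Min_in[OF \<open>finite A\<close> False] by simp
    then show "x \<in> {Min A..Min A + int D}"
      using x \<open>finite A\<close> by auto
  qed
  then have "card A \<le> card {Min A..Min A + int D}"
    by (intro card_mono) auto
  then show ?thesis by simp
qed simp

text \<open>For two admissible p the multiples p * k lie within M of the same number q * m, so they
  differ by at most 2M, and the two p by at most 2M / \<bar>k\<bar>.\<close>

lemma card_close_multiples_le:
  fixes q k m :: int and M :: nat
  assumes "k \<noteq> 0"
  shows "card {p\<in>{1..q}. \<bar>p * k - q * m\<bar> \<le> int M} \<le> 2 * M div nat \<bar>k\<bar> + 1"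
proof (rule card_int_diff_le)
  fix x y assume xy: "x \<in> {p\<in>{1..q}. \<bar>p * k - q * m\<bar> \<le> int M}"
    "y \<in> {p\<in>{1..q}. \<bar>p * k - q * m\<bar> \<le> int M}"
  have "(x - y) * \<bar>k\<bar> \<le> \<bar>(x - y) * k\<bar>"
    by (simp add: abs_mult mult_right_mono)
  also have "(x - y) * k = (x * k - q * m) - (y * k - q * m)"
    by (simp add: algebra_simps)
  also have "\<bar>\<dots>\<bar> \<le> 2 * int M"
    using xy by auto
  finally have "x - y \<le> 2 * int M div \<bar>k\<bar>"
    using assms zdiv_mono1[of "(x - y) * \<bar>k\<bar>" "2 * int M" "\<bar>k\<bar>"] by simp
  then show "x - y \<le> int (2 * M div nat \<bar>k\<bar>)"
    by (simp add: zdiv_int)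
qed (rule finite_subset[of _ "{1..q}"], auto)

text \<open>With M the floor of t, these conditions are what remains, after clearing denominators,
  when (p/q, 1/q) and (p'/q', 1/q') share a square of side t^(-3). Pairs are ordered and the
  diagonal is included.\<close>

definition close_pairs :: "nat \<Rightarrow> nat \<Rightarrow> ((nat \<times> nat) \<times> (nat \<times> nat)) set" where
  "close_pairs N M = {((q, p), (q', p')) | q p q' p'.
     (q, p) \<in> fraction_pairs N \<and> (q', p') \<in> fraction_pairs N \<and>
     \<bar>int q' - int q\<bar> \<le> int M \<and> \<bar>int p * int q' - int p' * int q\<bar> \<le> int M}"

text \<open>For each q, the shift k = 0 costs at most N and the 2M other shifts at most 9M each. The
  hypothesis \<open>M\<^sup>2 \<le> N\<close> turns N + 18 M^2 into 19 N;
  \<open>4 * M \<le> N\<close> forces \<bar>m\<bar> \<le> \<bar>k\<bar>.\<close>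

lemma card_close_pairs_le:
  assumes "M\<^sup>2 \<le> N" and "4 * M \<le> N"
  shows "card (close_pairs N M) \<le> 19 * N\<^sup>2"
proof -
  define A where "A q k m = {p\<in>{1..q}. \<bar>p * k - q * m\<bar> \<le> int M}" for q k m :: int
  \<comment> \<open>The numerator comes last, so that the innermost fibre, over fixed q, k, m, is
    the set bounded by \<open>card_close_multiples_le\<close>.\<close>
  define T where "T = (SIGMA q:{1..int N}. SIGMA k:{- int M..int M}. SIGMA m:{- \<bar>k\<bar>..\<bar>k\<bar>}. A q k m)"
  define g where "g = (\<lambda>((q, p), (q', p')).
    (int q, int q' - int q, int p' - int p, int p :: int) :: int \<times> int \<times> int \<times> int)"
  have finA [simp]: "finite (A q k m)" for q k m
    unfolding A_def by (rule finite_subset[of _ "{1..q}"]) auto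
  have finT: "finite T"
    unfolding T_def by (intro finite_SigmaI) auto
  have "g ` close_pairs N M \<subseteq> T"
  proof
    fix z assume "z \<in> g ` close_pairs N M"
    then obtain q p q' p' where z: "z = (int q, int q' - int q, int p' - int p, int p)"
      and S: "(q, p) \<in> fraction_pairs N" "(q', p') \<in> fraction_pairs N"
      and k: "\<bar>int q' - int q\<bar> \<le> int M" and r: "\<bar>int p * int q' - int p' * int q\<bar> \<le> int M"
      by (auto simp: g_def close_pairs_def)
    define k where "k = int q' - int q"
    define m where "m = int p' - int p"
    have q: "1 \<le> q" "q \<le> N" "N < 4 * q" "0 < p" "p \<le> q"
      using S by (auto simp: fraction_pairs_def totatives_def)
    have eq: "int p * int q' - int p' * int q = int p * k - int q * m"
      by (simp add: k_def m_def algebra_simps)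
    have "\<bar>m\<bar> * int q = \<bar>int q * m\<bar>"
      by (simp add: abs_mult)
    also have "\<dots> \<le> \<bar>int p * k\<bar> + int M"
      using r unfolding eq by linarith
    also have "\<bar>int p * k\<bar> \<le> int q * \<bar>k\<bar>"
      using q by (simp add: abs_mult mult_right_mono)
    \<comment> \<open>Since N < 4q, M is strictly below q; this strictness gives \<bar>m\<bar> <
      \<bar>k\<bar> + 1 instead of a weaker bound.\<close>
    also have "int M < int q"
      using assms(2) q by linarith
    finally have "\<bar>m\<bar> * int q < (\<bar>k\<bar> + 1) * int q"
      by (simp add: algebra_simps)
    then have "\<bar>m\<bar> \<le> \<bar>k\<bar>"
      using q by (simp add: mult_less_cancel_right)
    then show "z \<in> T"
      using q k r unfolding eq z T_def k_def[symmetric] m_def[symmetric] by (auto simp: A_def)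
  qed
  moreover have "inj_on g (close_pairs N M)"
    by (auto simp: inj_on_def g_def close_pairs_def)
  ultimately have "card (close_pairs N M) \<le> card T"
    using finT card_inj_on_le by blast
  also have "card T = (\<Sum>q\<in>{1..int N}. \<Sum>k\<in>{- int M..int M}. \<Sum>m\<in>{- \<bar>k\<bar>..\<bar>k\<bar>}. card (A q k m))"
    unfolding T_def by (simp add: card_SigmaI finite_SigmaI)
  also have "\<dots> \<le> (\<Sum>q\<in>{1..int N}. 19 * N)"
  proof (rule sum_mono)
    fix q assume q: "q \<in> {1..int N}"
    \<comment> \<open>For k = 0 only m = 0 remains and p is unrestricted in \<open>{1..q}\<close>.
      Writing the bound as a sum of two conditionals separates this term from the others when
      summing over k.\<close>
    have "(\<Sum>m\<in>{- \<bar>k\<bar>..\<bar>k\<bar>}. card (A q k m)) \<le> (if k = 0 then N else 0) + (if k = 0 then 0 else 9 * M)"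
      if k: "k \<in> {- int M..int M}" for k
    proof (cases "k = 0")
      case True
      have "nat q \<le> N"
        using q by auto
      moreover have "card (A q 0 0) \<le> card {1..q}"
        by (intro card_mono) (auto simp: A_def)
      ultimately show ?thesis
        using True by simp
    next
      case False
      define K where "K = nat \<bar>k\<bar>"
      have K: "1 \<le> K" "K \<le> M" "\<bar>k\<bar> = int K"
        using False k by (auto simp: K_def)
      have "(\<Sum>m\<in>{- \<bar>k\<bar>..\<bar>k\<bar>}. card (A q k m)) \<le> (\<Sum>m\<in>{- \<bar>k\<bar>..\<bar>k\<bar>}. 2 * M div K + 1)"
        unfolding A_def K_def using card_close_multiples_le[OF False] by (intro sum_mono) auto
      also have "\<dots> = (2 * K + 1) * (2 * M div K + 1)"
        using K(3) by (simp add: nat_add_distrib nat_mult_distrib)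
      also have "\<dots> = 2 * (K * (2 * M div K)) + 2 * K + 2 * M div K + 1"
        by (simp add: algebra_simps)
      \<comment> \<open>The four summands are at most 4M, 2M, 2M and M, using 1 \<le> K \<le>
        M.\<close>
      also have "\<dots> \<le> 9 * M"
        using times_div_less_eq_dividend[of K "2 * M"] div_le_dividend[of "2 * M" K] K by linarith
      finally show ?thesis
        using False by simp
    qed
    then have "(\<Sum>k\<in>{- int M..int M}. \<Sum>m\<in>{- \<bar>k\<bar>..\<bar>k\<bar>}. card (A q k m))
      \<le> (\<Sum>k\<in>{- int M..int M}. (if k = 0 then N else 0) + (if k = 0 then 0 else 9 * M))"
      by (rule sum_mono)
    also have "\<dots> = N + 9 * M * (2 * M)"
    proof -
      have "(\<Sum>k\<in>{- int M..int M}. if k = 0 then 0 else 9 * M) = (\<Sum>k\<in>{- int M..int M} - {0}. 9 * M)"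
        by (intro sum.mono_neutral_cong_right) auto
      also have "\<dots> = 9 * M * (2 * M)"
        by (simp add: card_Diff_singleton nat_add_distrib nat_mult_distrib)
      finally show ?thesis
        by (simp add: sum.distrib)
    qed
    also have "\<dots> \<le> 19 * N"
      using assms(1) by (simp add: power2_eq_square)
    finally show "(\<Sum>k\<in>{- int M..int M}. \<Sum>m\<in>{- \<bar>k\<bar>..\<bar>k\<bar>}. card (A q k m)) \<le> 19 * N" .
  qed
  also have "\<dots> = 19 * N\<^sup>2"
    by (simp add: power2_eq_square)
  finally show ?thesis .
qed

text \<open>Pairs with equal image number the sum of the squared fibre sizes, and Cauchy-Schwarz
  over the elements of \<open>C\<close> applies. With \<open>f\<close> choosing a cube for each
  point, few coincidences force many cubes.\<close>

lemma card_square_le_card_fibre_pairs: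
  assumes "finite S" and "finite C" and "f ` S \<subseteq> C"
  shows "(card S)\<^sup>2 \<le> card C * card {(x, y). x \<in> S \<and> y \<in> S \<and> f x = f y}"
proof -
  define B where "B c = {x\<in>S. f x = c}" for c
  have fB [simp]: "finite (B c)" for c
    using assms(1) by (simp add: B_def)
  have disj: "B c \<inter> B d = {}" if "c \<noteq> d" for c d
    using that by (auto simp: B_def)
  have "S = (\<Union>c\<in>C. B c)"
    using assms(3) by (auto simp: B_def)
  moreover have "card (\<Union>c\<in>C. B c) = (\<Sum>c\<in>C. card (B c))"
    using assms(2) disj by (intro card_UN_disjoint) simp_all
  ultimately have S: "card S = (\<Sum>c\<in>C. card (B c))"
    by simp
  have "{(x, y). x \<in> S \<and> y \<in> S \<and> f x = f y} = (\<Union>c\<in>C. B c \<times> B c)"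
    using assms(3) by (auto simp: B_def)
  moreover have "card (\<Union>c\<in>C. B c \<times> B c) = (\<Sum>c\<in>C. card (B c \<times> B c))"
    using assms(2) disj by (intro card_UN_disjoint) (simp_all add: Times_Int_Times)
  ultimately have P: "card {(x, y). x \<in> S \<and> y \<in> S \<and> f x = f y} = (\<Sum>c\<in>C. (card (B c))\<^sup>2)"
    by (simp add: card_cartesian_product power2_eq_square)
  have "(\<Sum>c\<in>C. real (card (B c)))\<^sup>2 \<le> (\<Sum>c\<in>C. (real (card (B c)))\<^sup>2) * card C"
    by (rule sum_squared_le_sum_of_squares)
  then have "real ((card S)\<^sup>2) \<le> real (card C * card {(x, y). x \<in> S \<and> y \<in> S \<and> f x = f y})"
    unfolding S P by (simp add: mult.commute)
  then show ?thesis
    by (simp only: of_nat_le_iff)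
qed

section \<open>Covering numbers and squares in the plane\<close>

lemma covering_number_le:
  assumes "\<C> \<subseteq> cubes \<delta>" "finite \<C>" "X \<subseteq> \<Union>\<C>"
  shows "covering_number \<delta> X \<le> card \<C>"
  unfolding covering_number_def by (rule Least_le) (use assms in blast)

text \<open>The given finite cover guarantees that the \<open>LEAST\<close> in
  \<open>covering_number\<close> is attained.\<close>

lemma optimal_cover:
  assumes "\<C> \<subseteq> cubes \<delta>" "finite \<C>" "X \<subseteq> \<Union>\<C>"
  obtains \<D> where "\<D> \<subseteq> cubes \<delta>" "finite \<D>" "card \<D> = covering_number \<delta> X" "X \<subseteq> \<Union>\<D>"
proof -
  have "\<exists>n. \<exists>\<D>. \<D> \<subseteq> cubes \<delta> \<and> finite \<D> \<and> card \<D> = n \<and> X \<subseteq> \<Union>\<D>"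
    using assms by blast
  from LeastI_ex[OF this] show ?thesis
    unfolding covering_number_def[symmetric] using that by blast
qed

lemma cube_prod:
  "cbox (x, y) ((x, y) + \<delta> *\<^sub>R (One :: real \<times> real)) = {x..x + \<delta>} \<times> {y..y + \<delta>}"
proof -
  have "(One :: real \<times> real) = (1, 1)"
    by (simp add: sum_Basis_prod_eq)
  then show ?thesis
    by (simp add: cbox_Pair_eq)
qed

lemma popcorn_graph_subset: "popcorn_graph \<subseteq> full_popcorn_set"
proof
  fix z assume "z \<in> popcorn_graph"
  then obtain x where x: "z = (x, popcorn x)" "x \<in> {0..1}"
    by (auto simp: popcorn_graph_def)
  show "z \<in> full_popcorn_set"
  proof (cases "\<exists>p q. reduced_fraction x p q")
    case True
    then obtain p q where pq: "reduced_fraction x p q" by blast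
    then have "z = (real p / real q, 1 / real q)" "0 < p" "p < q"
      using x popcorn_reduced_fraction[OF pq] by (auto simp: reduced_fraction_def)
    then show ?thesis
      unfolding full_popcorn_set_def by blast
  next
    case False
    then have "popcorn x = 0"
      by (simp add: popcorn_def)
    then show ?thesis
      using x by (simp add: full_popcorn_set_def)
  qed
qed

section \<open>Upper bound: an explicit cover\<close>

text \<open>Cutting at denominator t^2 balances the two families: about t^2 * t^2 squares for single
  points, and a grid of about t^3 by t squares for the strip below height t^(-2). Each is at most 4
  t^4.\<close>

lemma full_popcorn_set_cover:
  assumes t: "1 \<le> t"
  obtains \<C> where "\<C> \<subseteq> cubes (1 / t ^ 3)" "finite \<C>" "full_popcorn_set \<subseteq> \<Union>\<C>"
    "real (card \<C>) \<le> 8 * t ^ 4"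
proof -
  define \<delta> where "\<delta> = 1 / t ^ 3"
  have \<delta>: "0 < \<delta>" using t by (simp add: \<delta>_def)
  define N where "N = nat \<lfloor>t\<^sup>2\<rfloor>"
  define I where "I = nat \<lfloor>t ^ 3\<rfloor>"
  define J where "J = nat \<lfloor>t\<rfloor>"
  define Q :: "real \<times> real \<Rightarrow> (real \<times> real) set" where "Q z = cbox z (z + \<delta> *\<^sub>R One)" for z
  \<comment> \<open>Each point is the lower left corner of its own square. The index range is
    deliberately generous: it includes p \<ge> q and also q = 0, where division yields 0.\<close>
  define C1 where "C1 = (\<lambda>(p, q). Q (real p / real q, 1 / real q)) ` ({..N} \<times> {..N})"
  define C2 where "C2 = (\<lambda>(i, j). Q (real i * \<delta>, real j * \<delta>)) ` ({..I} \<times> {..J})"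
  have Q: "Q (x, y) = {x..x + \<delta>} \<times> {y..y + \<delta>}" for x y
    by (simp add: Q_def cube_prod)
  have grid: "x \<in> {real (nat \<lfloor>x / \<delta>\<rfloor>) * \<delta>..real (nat \<lfloor>x / \<delta>\<rfloor>) * \<delta> + \<delta>}" if "0 \<le> x" for x
  proof -
    have "real (nat \<lfloor>x / \<delta>\<rfloor>) \<le> x / \<delta>" "x / \<delta> \<le> real (nat \<lfloor>x / \<delta>\<rfloor>) + 1"
      using that \<delta> by (auto intro: of_nat_floor)
    then show ?thesis
      using \<delta> by (simp add: field_simps)
  qed
  have low: "(x, y) \<in> \<Union>C2" if "0 \<le> x" "x \<le> 1" "0 \<le> y" "y * t\<^sup>2 \<le> 1" for x y
  proof -
    have "x / \<delta> \<le> t ^ 3"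
      using that t by (simp add: \<delta>_def mult_left_le_one_le)
    then have i: "nat \<lfloor>x / \<delta>\<rfloor> \<le> I"
      unfolding I_def by (intro nat_mono floor_mono)
    have "y / \<delta> = (y * t\<^sup>2) * t"
      by (simp add: \<delta>_def power2_eq_square power3_eq_cube)
    also have "\<dots> \<le> 1 * t"
      using that t by (intro mult_right_mono) auto
    finally have j: "nat \<lfloor>y / \<delta>\<rfloor> \<le> J"
      unfolding J_def by (intro nat_mono floor_mono) simp
    have "(x, y) \<in> Q (real (nat \<lfloor>x / \<delta>\<rfloor>) * \<delta>, real (nat \<lfloor>y / \<delta>\<rfloor>) * \<delta>)"
      unfolding Q using grid[of x] grid[of y] that by blast
    then show ?thesis
      using i j unfolding C2_def by blast
  qed
  have cover: "full_popcorn_set \<subseteq> \<Union>(C1 \<union> C2)"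
  proof
    fix z assume "z \<in> full_popcorn_set"
    then consider p q where "z = (real p / real q, 1 / real q)" "0 < p" "p < q"
      | x where "z = (x, 0)" "0 \<le> x" "x \<le> 1"
      by (auto simp: full_popcorn_set_def)
    then show "z \<in> \<Union>(C1 \<union> C2)"
    proof cases
      case (1 p q)
      show ?thesis
      proof (cases "q \<le> N")
        case True
        have "z \<in> Q z" using \<delta> by (cases z) (simp add: Q)
        moreover have "Q z \<in> C1"
          unfolding C1_def using 1 True by (intro image_eqI[of _ _ "(p, q)"]) auto
        ultimately show ?thesis by blast
      next
        case False
        then have "t\<^sup>2 \<le> real q"
          unfolding N_def by linarith
        then have "1 / real q * t\<^sup>2 \<le> 1"
          using 1 by (simp add: field_simps)
        then show ?thesis
          using low[of "real p / real q" "1 / real q"] 1 by simp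
      qed
    next
      case 2
      then show ?thesis using low[of x 0] by simp
    qed
  qed
  \<comment> \<open>Index ranges start at 0; the additional 1 is absorbed into the factor 2 because
    t \<ge> 1.\<close>
  have N: "real N + 1 \<le> 2 * t\<^sup>2" and I: "real I + 1 \<le> 2 * t ^ 3" and J: "real J + 1 \<le> 2 * t"
    using t one_le_power[OF t, of 2] one_le_power[OF t, of 3]
    unfolding N_def I_def J_def by linarith+
  have "card C1 \<le> (N + 1) * (N + 1)"
    unfolding C1_def using card_image_le[of "{..N} \<times> {..N}"] by (simp add: card_cartesian_product)
  then have "real (card C1) \<le> real ((N + 1) * (N + 1))"
    by (rule of_nat_mono)
  also have "\<dots> = (real N + 1) * (real N + 1)"
    by (simp only: of_nat_mult of_nat_add of_nat_1)
  also have "\<dots> \<le> (2 * t\<^sup>2) * (2 * t\<^sup>2)"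
    using N t by (intro mult_mono) auto
  finally have c1: "real (card C1) \<le> 4 * t ^ 4"
    by (simp add: power2_eq_square power4_eq_xxxx)
  have "card C2 \<le> (I + 1) * (J + 1)"
    unfolding C2_def using card_image_le[of "{..I} \<times> {..J}"] by (simp add: card_cartesian_product)
  then have "real (card C2) \<le> real ((I + 1) * (J + 1))"
    by (rule of_nat_mono)
  also have "\<dots> = (real I + 1) * (real J + 1)"
    by (simp only: of_nat_mult of_nat_add of_nat_1)
  also have "\<dots> \<le> (2 * t ^ 3) * (2 * t)"
    using I J t by (intro mult_mono) auto
  finally have c2: "real (card C2) \<le> 4 * t ^ 4"
    by (simp add: power3_eq_cube power4_eq_xxxx)
  have "card (C1 \<union> C2) \<le> card C1 + card C2"
    by (rule card_Un_le)
  then have "real (card (C1 \<union> C2)) \<le> 8 * t ^ 4"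
    using c1 c2 by linarith
  moreover have "finite (C1 \<union> C2)"
    by (simp add: C1_def C2_def)
  moreover have "C1 \<union> C2 \<subseteq> cubes (1 / t ^ 3)"
    unfolding C1_def C2_def Q_def cubes_def \<delta>_def by auto
  ultimately show ?thesis
    using that cover by blast
qed

section \<open>Lower bound: few points share a square\<close>

text \<open>Clearing denominators multiplies by q * q' \<le> t^4, which turns t^(-3) into t. It
  serves twice: with the numerators p, p' for the abscissae, and with 1, 1 for the heights.\<close>

lemma close_fractions:
  fixes a b t :: real and q q' N :: nat
  assumes "\<bar>a / real q - b / real q'\<bar> \<le> 1 / t ^ 3" "0 < q" "0 < q'" "q \<le> N" "q' \<le> N"
    and "0 < t" "real N \<le> t\<^sup>2"
  shows "\<bar>a * real q' - b * real q\<bar> \<le> t"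
proof -
  have "a * real q' - b * real q = (a / real q - b / real q') * (real q * real q')"
    using assms by (simp add: field_simps)
  then have "\<bar>a * real q' - b * real q\<bar> = \<bar>a / real q - b / real q'\<bar> * (real q * real q')"
    by (simp add: abs_mult)
  also have "\<dots> \<le> 1 / t ^ 3 * (t\<^sup>2 * t\<^sup>2)"
    using assms by (intro mult_mono) auto
  also have "\<dots> = t"
    using assms by (simp add: power2_eq_square power3_eq_cube field_simps)
  finally show ?thesis .
qed

text \<open>Cauchy-Schwarz gives (N^2/16)^2 \<le> card * 19 N^2, and N \<ge> t^2/2 gives N^2 \<ge>
  t^4/4; hence 19456 = 4 * 256 * 19.\<close>

lemma popcorn_graph_cover_card_ge:
  assumes t: "8 \<le> t" and C: "\<C> \<subseteq> cubes (1 / t ^ 3)" "finite \<C>" "popcorn_graph \<subseteq> \<Union>\<C>"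
  shows "t ^ 4 / 19456 \<le> real (card \<C>)"
proof -
  define N where "N = nat \<lfloor>t\<^sup>2\<rfloor>"
  define M where "M = nat \<lfloor>t\<rfloor>"
  have tt: "8 * t \<le> t\<^sup>2"
    using t by (simp add: power2_eq_square)
  have N: "real N \<le> t\<^sup>2" "t\<^sup>2 / 2 \<le> real N" "8 \<le> N"
    unfolding N_def using t tt by linarith+
  have M: "real M \<le> t"
    unfolding M_def using t by linarith
  have "(real M)\<^sup>2 \<le> t\<^sup>2"
    using M by (intro power_mono) auto
  then have MN: "M\<^sup>2 \<le> N"
    unfolding N_def by (intro le_nat_floor) simp
  have MN4: "4 * M \<le> N"
    unfolding N_def by (intro le_nat_floor) (use M tt t in simp)
  define S where "S = fraction_pairs N"
  have S: "0 < q" "q \<le> N" "0 < p" "p < q" "coprime p q" if "(q, p) \<in> S" for q p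
  proof -
    have *: "0 < q" "q \<le> N" "N < 4 * q" "0 < p" "p \<le> q" "coprime p q"
      using that by (auto simp: S_def fraction_pairs_def totatives_def)
    \<comment> \<open>\<open>totatives q\<close> contains q only for q = 1, which N \<ge> 8 and N <
      4q exclude.\<close>
    moreover have "p \<noteq> q"
      using * \<open>8 \<le> N\<close> by auto
    ultimately show "0 < q" "q \<le> N" "0 < p" "p < q" "coprime p q"
      by auto
  qed
  define pt where "pt = (\<lambda>(q, p). (real p / real q, 1 / real q))"
  have "\<exists>c\<in>\<C>. pt z \<in> c" if "z \<in> S" for z
  proof -
    obtain q p where z: "z = (q, p)" by (cases z)
    have "reduced_fraction (real p / real q) p q"
      using S[of q p] that z by (auto simp: reduced_fraction_def)
    then have "pt z = (real p / real q, popcorn (real p / real q))"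
      by (simp add: pt_def z popcorn_reduced_fraction)
    moreover have "real p / real q \<in> {0..1}"
      using S[of q p] that z by auto
    ultimately have "pt z \<in> popcorn_graph"
      unfolding popcorn_graph_def by blast
    then show ?thesis using C(3) by blast
  qed
  \<comment> \<open>\<open>f\<close> selects one covering cube per fraction, so its fibres are
    groups of points in a common cube.\<close>
  then obtain f where f: "\<And>z. z \<in> S \<Longrightarrow> f z \<in> \<C>" "\<And>z. z \<in> S \<Longrightarrow> pt z \<in> f z"
    by metis
  have "{(x, y). x \<in> S \<and> y \<in> S \<and> f x = f y} \<subseteq> close_pairs N M"
  proof clarify
    fix q p q' p' assume xy: "(q, p) \<in> S" "(q', p') \<in> S" "f (q, p) = f (q', p')"
    obtain a where a: "f (q, p) = cbox a (a + (1 / t ^ 3) *\<^sub>R One)"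
      using f(1)[OF xy(1)] C(1) by (auto simp: cubes_def)
    obtain u v where "a = (u, v)" by (cases a)
    then have box: "f (q, p) = {u..u + 1 / t ^ 3} \<times> {v..v + 1 / t ^ 3}"
      using a by (simp only: cube_prod)
    have in1: "real p / real q \<in> {u..u + 1 / t ^ 3}" "1 / real q \<in> {v..v + 1 / t ^ 3}"
      using f(2)[OF xy(1)] unfolding box pt_def by auto
    have in2: "real p' / real q' \<in> {u..u + 1 / t ^ 3}" "1 / real q' \<in> {v..v + 1 / t ^ 3}"
      using f(2)[OF xy(2)] unfolding xy(3)[symmetric] box pt_def by auto
    have "\<bar>real p / real q - real p' / real q'\<bar> \<le> 1 / t ^ 3" "\<bar>1 / real q - 1 / real q'\<bar> \<le> 1 / t ^ 3"
      using in1 in2 unfolding atLeastAtMost_iff by linarith+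
    then have "\<bar>real p * real q' - real p' * real q\<bar> \<le> t" "\<bar>1 * real q' - 1 * real q\<bar> \<le> t"
      using close_fractions[of "real p" q "real p'" q' t N] close_fractions[of 1 q 1 q' t N]
        S[OF xy(1)] S[OF xy(2)] N t by auto
    then have "real_of_int \<bar>int p * int q' - int p' * int q\<bar> \<le> t"
      "real_of_int \<bar>int q' - int q\<bar> \<le> t"
      by simp_all
    \<comment> \<open>Integers bounded by t are bounded by its floor M.\<close>
    then have "\<bar>int p * int q' - int p' * int q\<bar> \<le> int M" "\<bar>int q' - int q\<bar> \<le> int M"
      unfolding M_def by linarith+
    then show "((q, p), (q', p')) \<in> close_pairs N M"
      using xy unfolding close_pairs_def S_def by blast
  qed
  moreover have "finite (close_pairs N M)"
    by (rule finite_subset[of _ "fraction_pairs N \<times> fraction_pairs N"]) (auto simp: close_pairs_def)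
  ultimately have pairs: "card {(x, y). x \<in> S \<and> y \<in> S \<and> f x = f y} \<le> 19 * N\<^sup>2"
    using card_mono card_close_pairs_le[OF MN MN4] order_trans by blast
  have "(card S)\<^sup>2 \<le> card \<C> * card {(x, y). x \<in> S \<and> y \<in> S \<and> f x = f y}"
    using f(1) C(2) by (intro card_square_le_card_fibre_pairs) (auto simp: S_def)
  also have "\<dots> \<le> card \<C> * (19 * N\<^sup>2)"
    using pairs by (rule mult_left_mono) simp
  finally have "real ((card S)\<^sup>2) \<le> real (card \<C> * (19 * N\<^sup>2))"
    by (simp only: of_nat_le_iff)
  moreover have "(real N ^ 2 / 16)\<^sup>2 \<le> (real (card S))\<^sup>2"
    unfolding S_def by (intro power_mono card_fraction_pairs_ge) simp
  ultimately have "(real N ^ 2 / 16)\<^sup>2 \<le> real (card \<C>) * 19 * (real N)\<^sup>2"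
    unfolding of_nat_mult of_nat_power of_nat_numeral mult.assoc by (rule order_trans[rotated])
  then have "(real N)\<^sup>2 * ((real N)\<^sup>2 / 256) \<le> (real N)\<^sup>2 * (real (card \<C>) * 19)"
    by (simp add: power2_eq_square mult_ac)
  then have "(real N)\<^sup>2 / 256 \<le> real (card \<C>) * 19"
    by (rule mult_left_le_imp_le) (use \<open>8 \<le> N\<close> in simp)
  moreover have "(t\<^sup>2 / 2)\<^sup>2 \<le> (real N)\<^sup>2"
    using N by (intro power_mono) auto
  moreover have "(t\<^sup>2 / 2)\<^sup>2 = t ^ 4 / 4"
    by (simp add: power_divide)
  ultimately show ?thesis
    by linarith
qed

section \<open>From covering bounds to the dimension\<close>

text \<open>A cover of the full set covers \<open>X\<close>, and a cover of \<open>X\<close> covers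
  the graph. Treating every set in between handles both sets of the theorem at once.\<close>

lemma popcorn_covering_number_bounds:
  assumes t: "8 \<le> t" and X: "popcorn_graph \<subseteq> X" "X \<subseteq> full_popcorn_set"
  shows "t ^ 4 / 19456 \<le> real (covering_number (1 / t ^ 3) X)"
    and "real (covering_number (1 / t ^ 3) X) \<le> 8 * t ^ 4"
proof -
  obtain \<C> where C: "\<C> \<subseteq> cubes (1 / t ^ 3)" "finite \<C>" "full_popcorn_set \<subseteq> \<Union>\<C>"
    "real (card \<C>) \<le> 8 * t ^ 4"
    using full_popcorn_set_cover[of t] t by force
  have XC: "X \<subseteq> \<Union>\<C>"
    using C X by blast
  show "real (covering_number (1 / t ^ 3) X) \<le> 8 * t ^ 4"
    using covering_number_le[OF C(1,2) XC] C(4) by linarith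
  obtain \<D> where "\<D> \<subseteq> cubes (1 / t ^ 3)" "finite \<D>"
    "card \<D> = covering_number (1 / t ^ 3) X" "X \<subseteq> \<Union>\<D>"
    using optimal_cover[OF C(1,2) XC] .
  then show "t ^ 4 / 19456 \<le> real (covering_number (1 / t ^ 3) X)"
    using popcorn_graph_cover_card_ge[OF t, of \<D>] X by auto
qed

text \<open>After taking logarithms, the constants contribute only ln c / (- ln \<delta>) and ln C /
  (- ln \<delta>), which tend to 0. The sandwiched quotient converges, so its lower and upper limits
  agree.\<close>

lemma has_box_dim_if_power_bounds:
  fixes X :: "'a::euclidean_space set"
  assumes "0 < c" and "\<forall>\<^sub>F \<delta> in at_right 0.
    c * \<delta> powr - s \<le> real (covering_number \<delta> X) \<and> real (covering_number \<delta> X) \<le> C * \<delta> powr - s"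
  shows "has_box_dim X s"
proof -
  let ?g = "\<lambda>\<delta>. ln (real (covering_number \<delta> X)) / (- ln \<delta>)"
  have lim: "((\<lambda>\<delta>. s + ln b / (- ln \<delta>)) \<longlongrightarrow> s) (at_right 0)" for b :: real
    by real_asymp
  have small: "\<forall>\<^sub>F \<delta> in at_right (0::real). \<delta> < 1 \<and> 0 < \<delta>"
    by (auto simp: eventually_at_right_field intro!: exI[of _ 1])
  have ev: "\<forall>\<^sub>F \<delta> in at_right 0. s + ln c / (- ln \<delta>) \<le> ?g \<delta> \<and> ?g \<delta> \<le> s + ln C / (- ln \<delta>)"
    using assms(2) small
  proof eventually_elim
    case (elim \<delta>)
    define n where "n = real (covering_number \<delta> X)"
    have L: "0 < - ln \<delta>" and pw: "0 < \<delta> powr - s"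
      using elim by auto
    have lo: "c * \<delta> powr - s \<le> n" and hi: "n \<le> C * \<delta> powr - s"
      using elim by (auto simp: n_def)
    have pos: "0 < c * \<delta> powr - s"
      using assms(1) pw by simp
    then have n: "0 < n" and "0 < C * \<delta> powr - s"
      using lo hi by linarith+
    \<comment> \<open>Positivity of \<open>C\<close> is inherited from the lower bound through the
      covering number.\<close>
    then have "0 < C"
      using pw by (simp add: zero_less_mult_iff)
    have "ln c + s * (- ln \<delta>) = ln (c * \<delta> powr - s)"
      using assms(1) elim by (simp add: ln_mult ln_powr)
    also have "\<dots> \<le> ln n"
      using pos lo n by (simp only: ln_le_cancel_iff)
    finally have "ln c + s * (- ln \<delta>) \<le> ln n" .
    moreover have "ln n \<le> ln C + s * (- ln \<delta>)"
    proof -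
      have "ln n \<le> ln (C * \<delta> powr - s)"
        using n hi \<open>0 < C * \<delta> powr - s\<close> by (simp only: ln_le_cancel_iff)
      also have "\<dots> = ln C + s * (- ln \<delta>)"
        using \<open>0 < C\<close> elim by (simp add: ln_mult ln_powr)
      finally show ?thesis .
    qed
    moreover have "s + ln b / (- ln \<delta>) = (ln b + s * (- ln \<delta>)) / (- ln \<delta>)" for b
      using L by (simp add: diff_divide_distrib)
    ultimately show ?case
      unfolding n_def[symmetric] using L by (simp only: divide_right_mono less_imp_le simp_thms)
  qed
  have "(?g \<longlongrightarrow> s) (at_right 0)"
    by (rule tendsto_sandwich[OF _ _ lim[of c] lim[of C]]) (use ev in \<open>auto elim: eventually_mono\<close>)
  then have "((\<lambda>\<delta>. ereal (?g \<delta>)) \<longlongrightarrow> ereal s) (at_right 0)"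
    by simp
  then show ?thesis
    unfolding has_box_dim_def lower_box_dim_def upper_box_dim_def
    by (simp add: lim_imp_Liminf lim_imp_Limsup)
qed

text \<open>The bounds in t hold for all real t \<ge> 8, so t = \<delta>^(-1/3) reaches every small
  \<delta> directly, without interpolating between scales. The threshold 1/512 is 8^(-3).\<close>

lemma has_box_dim_between_popcorn_sets:
  assumes X: "popcorn_graph \<subseteq> X" "X \<subseteq> full_popcorn_set"
  shows "has_box_dim X (4 / 3)"
proof (rule has_box_dim_if_power_bounds)
  have small: "\<forall>\<^sub>F \<delta> in at_right (0::real). \<delta> < 1 / 512 \<and> 0 < \<delta>"
    by (auto simp: eventually_at_right_field intro!: exI[of _ "1 / 512"])
  then show "\<forall>\<^sub>F \<delta> in at_right 0.
    1 / 19456 * \<delta> powr - (4 / 3) \<le> real (covering_number \<delta> X) \<and>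
    real (covering_number \<delta> X) \<le> 8 * \<delta> powr - (4 / 3)"
  proof eventually_elim
    case (elim \<delta>)
    define t where "t = \<delta> powr - (1 / 3)"
    have "t ^ 3 = \<delta> powr - 1" and t4: "t ^ 4 = \<delta> powr - (4 / 3)"
      using elim by (auto simp: t_def powr_realpow[symmetric] powr_powr)
    then have t3: "t ^ 3 = 1 / \<delta>"
      using elim by (simp add: powr_minus_divide)
    have "(8::real) ^ 3 \<le> t ^ 3"
      using elim by (simp add: t3 field_simps)
    then have "8 \<le> t"
      by (rule power_le_imp_le_base[of _ 2, simplified]) (simp_all add: t_def)
    from popcorn_covering_number_bounds[OF this X] show ?case
      by (simp add: t3 t4)
  qed
qed simp

theorem theorem2p1:
  "has_box_dim full_popcorn_set (4 / 3) \<and> has_box_dim popcorn_graph (4 / 3)"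
  by (simp add: has_box_dim_between_popcorn_sets popcorn_graph_subset)

end
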